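(* Let $F=f+\delta_{\mathcal D_P}$ be as in the context and let $x^*\in\mathcal D_P$ be a critical point of $F$. Suppose that the KŁ exponent of $F$ at $x^*$ is $1/2$ and that $\nabla f$ is locally Lipschitz continuous at $x^*$ (i.e. Lipschitz on some neighborhood of $x^*$). Suppose further that strict complementarity holds at $x^*$: there exist $\mu^*\in\mathbb R^m$ and $\lambda^*\in\mathbb R^n$ with $\nabla f(x^* )+A^\top\mu^*-\lambda^*=0$, $\lambda^*\ge0$, $(\lambda^* )^\top x^*=0$ and $x^*+\lambda^*\in\mathbb R^n_{++}$. Then the SKŁ exponent of $F$ at $x^*$ is $1/2$, i.e. $F$ has the SKŁ property at $x^*$ with exponent $1/2$.
   Context: Setting. $A\in\mathbb R^{m\times n}$ has full row rank, $b\in\mathbb R^m$, $\mathcal D_P=\{x\in\mathbb R^n: Ax=b,\ x\ge 0\}$, and $\mathcal D_P\cap\mathbb R^n_{++}\neq\emptyset$. $h_S(x)=\sum_{i=1}^n x_i\log x_i$ on $\mathbb R^n_+$ (with $0\log 0=0$). The function $f:\mathbb R^n\to\mathbb R$ is continuously differentiable (not necessarily convex) and $L$-relatively smooth with respect to $h_S$ on $\mathcal D_P$ for some $L>0$, i.e. $Lh_S-f$ is convex on $\mathcal D_P$. The problem $\min_{x\in\mathcal D_P} f(x)$ is assumed to have an optimal solution. $F=f+\delta_{\mathcal D_P}$, where $\delta_{\mathcal D_P}$ is $0$ on $\mathcal D_P$ and $+\infty$ elsewhere. Subdifferential. $\partial F$ denotes the limiting subdifferential; for $x\in\mathcal D_P$,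 $\partial F(x)=\{\nabla f(x)+A^\top\mu-\lambda:\mu\in\mathbb R^m,\ \lambda\ge0,\ \lambda^\top x=0\}$. A critical point of $F$ is a point $\bar x$ with $0\in\partial F(\bar x)$. KŁ exponent $1/2$ at $x^*$: there exist $c,\epsilon,\eta>0$ such that $F(x)-F(x^* )\le c\,\operatorname{dist}(0,\partial F(x))^2$ for all $x$ with $\|x-x^*\|_2\le\epsilon$ and $F(x^* )<F(x)<F(x^* )+\eta$. SKŁ exponent $1/2$ at $x^*$: there exist $\tilde c>0$, $\eta\in(0,+\infty]$ and a neighborhood $\mathcal U$ of $x^*$ such that, with $\varphi(s)=\tilde c\,s^{1/2}$, $\varphi'(F(x)-F(x^* ))\cdot\operatorname{dist}(0,\operatorname{Diag}(\sqrt x)\,\partial F(x))\ge1$ for all $x\in\mathcal U$ with $F(x^* )<F(x)<F(x^* )+\eta$. Here $\sqrt x$ is taken entrywise and $\operatorname{dist}$ is Euclidean distance. *)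

theory Defs
  imports "HOL-Analysis.Analysis"
begin

definition feasible :: "real^'n^'m \<Rightarrow> real^'m \<Rightarrow> (real^'n) set" where
  "feasible A b = {x. A *v x = b \<and> (\<forall>i. 0 \<le> x $ i)}"

(* The convention 0 log 0 = 0 holds automatically. *)
definition h_S :: "real^'n \<Rightarrow> real" where
  "h_S x = (\<Sum>i\<in>UNIV. x $ i * ln (x $ i))"

definition rel_smooth_on :: "(real^'n) set \<Rightarrow> real \<Rightarrow> (real^'n \<Rightarrow> real) \<Rightarrow> (real^'n \<Rightarrow> real) \<Rightarrow> bool" where
  "rel_smooth_on D L h f \<longleftrightarrow> convex_on D (\<lambda>x. L * h x - f x)"

definition set_delta :: "'a set \<Rightarrow> 'a \<Rightarrow> ereal" where
  "set_delta S x = (if x \<in> S then 0 else \<infinity>)"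

definition regular_subdiff :: "('a::euclidean_space \<Rightarrow> ereal) \<Rightarrow> 'a \<Rightarrow> 'a set" where
  "regular_subdiff F x = {v. \<bar>F x\<bar> \<noteq> \<infinity> \<and>
     0 \<le> Liminf (at x) (\<lambda>y. (F y - F x - ereal (v \<bullet> (y - x))) / ereal (norm (y - x)))}"

definition limiting_subdiff :: "('a::euclidean_space \<Rightarrow> ereal) \<Rightarrow> 'a \<Rightarrow> 'a set" where
  "limiting_subdiff F x = {v. \<bar>F x\<bar> \<noteq> \<infinity> \<and>
     (\<exists>X V. X \<longlonglongrightarrow> x \<and> (\<lambda>k. F (X k)) \<longlonglongrightarrow> F x \<and>
        (\<forall>k::nat. V k \<in> regular_subdiff F (X k)) \<and> V \<longlonglongrightarrow> v)}"

definition critical_point :: "('a::euclidean_space \<Rightarrow> ereal) \<Rightarrow> 'a \<Rightarrow> bool" where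
  "critical_point F x \<longleftrightarrow> 0 \<in> limiting_subdiff F x"

(* Distance from the origin; unlike infdist, it is infinite for the empty set. *)
definition dist0 :: "'a::euclidean_space set \<Rightarrow> ereal" where
  "dist0 S = (INF v\<in>S. ereal (dist 0 v))"

definition KL_exponent_half :: "('a::euclidean_space \<Rightarrow> ereal) \<Rightarrow> 'a \<Rightarrow> bool" where
  "KL_exponent_half F xs \<longleftrightarrow>
     (\<exists>c \<epsilon> \<eta> :: real. 0 < c \<and> 0 < \<epsilon> \<and> 0 < \<eta> \<and>
        (\<forall>x. norm (x - xs) \<le> \<epsilon> \<and> F xs < F x \<and> F x < F xs + ereal \<eta> \<longrightarrow>
           F x - F xs \<le> ereal c * (dist0 (limiting_subdiff F x))\<^sup>2))"

definition diag_sqrt :: "real^'n \<Rightarrow> real^'n \<Rightarrow> real^'n" where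
  "diag_sqrt x v = (\<chi> i. sqrt (x $ i) * v $ i)"

definition SKL_exponent_half :: "(real^'n \<Rightarrow> ereal) \<Rightarrow> real^'n \<Rightarrow> bool" where
  "SKL_exponent_half F xs \<longleftrightarrow>
     (\<exists>(c::real) (\<eta>::ereal) U. 0 < c \<and> 0 < \<eta> \<and> open U \<and> xs \<in> U \<and>
        (\<forall>x\<in>U. F xs < F x \<and> F x < F xs + \<eta> \<longrightarrow>
           1 \<le> ereal (deriv (\<lambda>s. c * s powr (1/2)) (real_of_ereal (F x - F xs)))
                 * dist0 (diag_sqrt x ` limiting_subdiff F x)))"

end

(* Let J be the set of active coordinates of xs. Strict complementarity gives gradf xs . z >= l s for
   z in ker A with z_J = x_J >= 0, where s = sum of x_J. For v in the subdifferential at x, v agrees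
   with gradf x on directions of ker A supported in supp x. Write W = sum x_i v_i^2, which is the
   squared norm of Diag(sqrt x) v; off J it controls v_I since x_I stays away from 0. Move x to the face
   {y_J = 0} along a lift z of x_J with norm z <= M s. Then P = sum of v_j x_j over J is at least
   (l/2) s when v_I is small, and P^2 <= s W by Cauchy-Schwarz, so P, s and f x - f y are all O(W).
   At y = x - z the projection u of gradf y onto {A w = 0, w_J = 0} is a subgradient by strict
   complementarity, with norm u = O(s) + norm v_I, so the KL inequality at y bounds f y - f xs by O(W).
   If v_I is not small, W is bounded below and there is nothing to prove. *)
theory Submission
  imports Defs
begin

section \<open>Subgradients of a smooth function plus an indicator\<close>

lemma regular_subdiff_subset_limiting: "regular_subdiff F x \<subseteq> limiting_subdiff F x"
proof
  fix v assume v: "v \<in> regular_subdiff F x"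
  then have "\<bar>F x\<bar> \<noteq> \<infinity>" by (simp add: regular_subdiff_def)
  moreover have "(\<lambda>_::nat. x) \<longlonglongrightarrow> x" "(\<lambda>_::nat. F x) \<longlonglongrightarrow> F x" "(\<lambda>_::nat. v) \<longlonglongrightarrow> v"
    by simp_all
  ultimately show "v \<in> limiting_subdiff F x"
    using v unfolding limiting_subdiff_def
    by (intro CollectI conjI exI[of _ "\<lambda>_. x"] exI[of _ "\<lambda>_. v"]) simp_all
qed

text \<open>The third assumption puts \<open>u - g\<close> in the normal cone of \<open>S\<close> at
  \<open>x\<close>. On \<open>S\<close> the quotient is therefore at least the first-order remainder
  of \<open>f\<close> divided by the distance, which tends to 0; off \<open>S\<close> the quotient
  is infinite.\<close>

lemma regular_subdiff_constrainedI:
  fixes f :: "'a::euclidean_space \<Rightarrow> real"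
  assumes g: "GDERIV f x :> g" and x: "x \<in> S"
    and u: "\<And>y. y \<in> S \<Longrightarrow> u \<bullet> (y - x) \<le> g \<bullet> (y - x)"
  shows "u \<in> regular_subdiff (\<lambda>x. ereal (f x) + set_delta S x) x"
proof -
  let ?F = "\<lambda>x. ereal (f x) + set_delta S x"
  let ?q = "\<lambda>y. (?F y - ?F x - ereal (u \<bullet> (y - x))) / ereal (norm (y - x))"
  have "0 \<le> Liminf (at x) ?q"
    unfolding le_Liminf_iff
  proof (intro allI impI)
    fix m :: ereal assume "m < 0"
    then obtain r where r: "m < ereal r" "ereal r < 0" using ereal_dense2 by blast
    have "0 < - r" using r by simp
    with g have ev: "\<forall>\<^sub>F y in at x. norm (f y - f x - (y - x) \<bullet> g) \<le> - r * norm (y - x)"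
      unfolding gderiv_def has_derivative_within_alt2 by blast
    have "\<forall>\<^sub>F y in at x. y \<noteq> x" by (simp add: eventually_at_filter)
    with ev show "\<forall>\<^sub>F y in at x. m < ?q y"
    proof eventually_elim
      case (elim y)
      have pos: "0 < norm (y - x)" using elim by simp
      show ?case
      proof (cases "y \<in> S")
        case True
        have "r * norm (y - x) \<le> f y - f x - u \<bullet> (y - x)"
          using elim(1) u[OF True] by (simp add: inner_commute abs_le_iff)
        then have "r \<le> (f y - f x - u \<bullet> (y - x)) / norm (y - x)"
          using pos by (simp add: pos_le_divide_eq)
        then have "ereal r \<le> ?q y" using True x pos by (simp add: set_delta_def)
        then show ?thesis using r(1) by (rule less_le_trans[rotated])
      next
        case False
        then have "?q y = \<infinity>" using x pos by (simp add: set_delta_def)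
        then show ?thesis using r by (cases m) auto
      qed
    qed
  qed
  then show ?thesis using x by (simp add: regular_subdiff_def set_delta_def)
qed

text \<open>Along a ray that starts inside \<open>S\<close> the indicator vanishes, so the lower
  limit of the quotient can be compared with the directional derivative of \<open>f\<close>.\<close>

lemma regular_subdiff_constrained_direction:
  fixes f :: "'a::euclidean_space \<Rightarrow> real"
  assumes g: "GDERIV f x :> g" and x: "x \<in> S"
    and v: "v \<in> regular_subdiff (\<lambda>x. ereal (f x) + set_delta S x) x"
    and z: "\<forall>\<^sub>F t in at_right 0. x + t *\<^sub>R z \<in> S"
  shows "v \<bullet> z \<le> g \<bullet> z"
proof (cases "z = 0")
  case False
  let ?F = "\<lambda>x. ereal (f x) + set_delta S x"
  let ?q = "\<lambda>y. (?F y - ?F x - ereal (v \<bullet> (y - x))) / ereal (norm (y - x))"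
  have "((\<lambda>t. x + t *\<^sub>R z) \<longlongrightarrow> x + 0 *\<^sub>R z) (at_right (0::real))"
    by (intro tendsto_intros)
  moreover have "\<forall>\<^sub>F t in at_right (0::real). x + t *\<^sub>R z \<noteq> x"
    using False by (simp add: eventually_at_filter)
  ultimately have lim: "filterlim (\<lambda>t. x + t *\<^sub>R z) (at x) (at_right (0::real))"
    by (simp add: filterlim_at)
  \<comment> \<open>The factor 2 collects two errors of size \<open>e\<close>: one from the lower
    limit, one from the first-order expansion of \<open>f\<close>.\<close>
  have step: "v \<bullet> z \<le> g \<bullet> z + e * (2 * norm z)" if e: "0 < e" for e
  proof -
    have "0 \<le> Liminf (at x) ?q" using v by (simp add: regular_subdiff_def)
    then have "\<forall>\<^sub>F y in at x. ereal (- e) < ?q y" using e by (simp add: le_Liminf_iff)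
    moreover have "\<forall>\<^sub>F y in at x. norm (f y - f x - (y - x) \<bullet> g) \<le> e * norm (y - x)"
      using g e unfolding gderiv_def has_derivative_within_alt2 by blast
    ultimately have "\<forall>\<^sub>F y in at x. ereal (- e) < ?q y \<and>
        norm (f y - f x - (y - x) \<bullet> g) \<le> e * norm (y - x)"
      by (rule eventually_conj)
    from eventually_compose_filterlim[OF this lim]
    have "\<forall>\<^sub>F t in at_right 0. (ereal (- e) < ?q (x + t *\<^sub>R z) \<and>
        norm (f (x + t *\<^sub>R z) - f x - (x + t *\<^sub>R z - x) \<bullet> g) \<le> e * norm (x + t *\<^sub>R z - x))
        \<and> x + t *\<^sub>R z \<in> S \<and> 0 < t"
      using z by (rule eventually_conj[OF _ eventually_conj[OF _ eventually_at_right_less]])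
    then obtain t where t: "ereal (- e) < ?q (x + t *\<^sub>R z)"
        "norm (f (x + t *\<^sub>R z) - f x - (t *\<^sub>R z) \<bullet> g) \<le> e * norm (t *\<^sub>R z)"
        "x + t *\<^sub>R z \<in> S" "0 < t"
      using eventually_happens'[OF trivial_limit_at_right_real] by fastforce
    have pos: "0 < t * norm z" using t(4) False by simp
    have "- e < (f (x + t *\<^sub>R z) - f x - t * (v \<bullet> z)) / (t * norm z)"
      using t x False by (simp add: set_delta_def)
    then have "- e * (t * norm z) < f (x + t *\<^sub>R z) - f x - t * (v \<bullet> z)"
      using pos by (simp add: pos_less_divide_eq)
    moreover have "f (x + t *\<^sub>R z) - f x - t * (g \<bullet> z) \<le> e * (t * norm z)"
      using t(2,4) by (simp add: inner_commute)
    ultimately have "t * (v \<bullet> z) \<le> t * (g \<bullet> z + e * (2 * norm z))"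
      by (simp add: algebra_simps)
    then show ?thesis using t(4) by simp
  qed
  show ?thesis
  proof (rule field_le_epsilon)
    fix e :: real assume "0 < e"
    then show "v \<bullet> z \<le> g \<bullet> z + e"
      using step[of "e / (2 * norm z)"] False by simp
  qed
qed simp

text \<open>Positive coordinates stay nonnegative for short times and zero coordinates do not move.
  The condition on \<open>z\<close> is symmetric, so it also serves \<open>- z\<close>.\<close>

lemma feasible_direction:
  assumes "x \<in> feasible A b" "A *v z = 0" "\<And>i. x $ i = 0 \<Longrightarrow> z $ i = 0"
  shows "\<forall>\<^sub>F t in at_right 0. x + t *\<^sub>R z \<in> feasible A b"
proof -
  have "\<forall>\<^sub>F t in at_right 0. 0 \<le> x $ i + t * z $ i" for i
  proof (cases "x $ i = 0")
    case False
    then have "0 < x $ i + 0 * z $ i" using assms(1) by (simp add: feasible_def less_le)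
    moreover have "((\<lambda>t. x $ i + t * z $ i) \<longlongrightarrow> x $ i + 0 * z $ i) (at_right 0)"
      by (intro tendsto_intros)
    ultimately have "\<forall>\<^sub>F t in at_right 0. 0 < x $ i + t * z $ i"
      by (metis order_tendstoD(1))
    then show ?thesis by (rule eventually_mono) simp
  qed (simp add: assms(3))
  then have "\<forall>\<^sub>F t in at_right 0. \<forall>i. 0 \<le> x $ i + t * z $ i"
    by (simp add: eventually_all_finite)
  then show ?thesis
    by (rule eventually_mono)
      (use assms in \<open>simp add: feasible_def matrix_vector_right_distrib matrix_vector_mult_scaleR\<close>)
qed

text \<open>This is all that is needed from the explicit subdifferential formula. Nonzero
  coordinates of \<open>x\<close> remain nonzero along \<open>X\<close>, so \<open>z\<close> and
  \<open>- z\<close> are eventually feasible at \<open>X k\<close>; the equality obtained there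
  passes to the limit by continuity of \<open>gradf\<close>.\<close>

lemma limiting_subdiff_feasible_direction:
  fixes f :: "real^'n \<Rightarrow> real"
  assumes g: "\<And>x. GDERIV f x :> gradf x" and cont: "continuous_on UNIV gradf"
    and v: "v \<in> limiting_subdiff (\<lambda>x. ereal (f x) + set_delta (feasible A b) x) x"
    and z: "A *v z = 0" "\<And>i. x $ i = 0 \<Longrightarrow> z $ i = 0"
  shows "v \<bullet> z = gradf x \<bullet> z"
proof -
  let ?F = "\<lambda>x. ereal (f x) + set_delta (feasible A b) x"
  obtain X V where X: "X \<longlonglongrightarrow> x" and V: "V \<longlonglongrightarrow> v"
    and sub: "\<And>k::nat. V k \<in> regular_subdiff ?F (X k)"
    using v unfolding limiting_subdiff_def by blast
  have XS: "X k \<in> feasible A b" for k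
    using sub[of k] by (auto simp: regular_subdiff_def set_delta_def split: if_splits)
  have "\<forall>\<^sub>F k in sequentially. X k $ i = 0 \<longrightarrow> z $ i = 0" for i
  proof (cases "x $ i = 0")
    case False
    have "(\<lambda>k. X k $ i) \<longlonglongrightarrow> x $ i" using X by (intro tendsto_intros)
    from tendsto_imp_eventually_ne[OF this False] show ?thesis
      by (rule eventually_mono) simp
  qed (simp add: z)
  then have "\<forall>\<^sub>F k in sequentially. \<forall>i. X k $ i = 0 \<longrightarrow> z $ i = 0"
    by (simp add: eventually_all_finite)
  then have "\<forall>\<^sub>F k in sequentially. V k \<bullet> z = gradf (X k) \<bullet> z"
  proof (rule eventually_mono)
    fix k assume k: "\<forall>i. X k $ i = 0 \<longrightarrow> z $ i = 0"
    have "V k \<bullet> d \<le> gradf (X k) \<bullet> d" if "A *v d = 0" "\<And>i. X k $ i = 0 \<Longrightarrow> d $ i = 0" for d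
      by (rule regular_subdiff_constrained_direction[OF g XS sub feasible_direction[OF XS that]])
    from this[of z] this[of "- z"] show "V k \<bullet> z = gradf (X k) \<bullet> z"
      using k z(1) matrix_vector_mult_scaleR[of A "- 1" z] by simp
  qed
  then have "(\<lambda>k. V k \<bullet> z) \<longlonglongrightarrow> gradf x \<bullet> z \<longleftrightarrow> (\<lambda>k. gradf (X k) \<bullet> z) \<longlonglongrightarrow> gradf x \<bullet> z"
    by (rule tendsto_cong)
  moreover have "(\<lambda>k. V k \<bullet> z) \<longlonglongrightarrow> v \<bullet> z" using V by (intro tendsto_intros)
  moreover have "(\<lambda>k. gradf (X k) \<bullet> z) \<longlonglongrightarrow> gradf x \<bullet> z"
    using continuous_on_tendsto_compose[OF cont X] by (intro tendsto_intros) simp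
  ultimately show ?thesis using LIMSEQ_unique by blast
qed

section \<open>Kernel lifts, a descent estimate and the scalar bound\<close>

text \<open>Restriction to the coordinates in \<open>J\<close> has a linear right inverse on the
  image of the kernel, and linear maps in finite dimension are bounded. The lift replaces a kernel
  vector by one whose size is governed by its \<open>J\<close>-coordinates alone.\<close>

lemma kernel_lift_bound:
  fixes A :: "real^'n^'m" and J :: "'n set"
  obtains M where "1 \<le> M" and
    "\<And>z. A *v z = 0 \<Longrightarrow>
      \<exists>z'. A *v z' = 0 \<and> (\<forall>j\<in>J. z' $ j = z $ j) \<and> norm z' \<le> M * (\<Sum>j\<in>J. \<bar>z $ j\<bar>)"
proof -
  define p :: "real^'n \<Rightarrow> real^'n" where "p z = (\<chi> i. if i \<in> J then z $ i else 0)" for z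
  have "linear p" by (auto simp: p_def linear_iff vec_eq_iff)
  moreover have "subspace {z. A *v z = 0}"
    by (simp add: subspace_def matrix_vector_right_distrib matrix_vector_mult_scaleR)
  ultimately obtain g where g: "range g \<subseteq> {z. A *v z = 0}" "linear g"
      "\<forall>v\<in>p ` {z. A *v z = 0}. p (g v) = v"
    using linear_exists_right_inverse_on[of p "{z. A *v z = 0}"] by blast
  obtain B where B: "0 < B" "\<And>x. norm (g x) \<le> B * norm x"
    using linear_bounded_pos[OF g(2)] by blast
  show ?thesis
  \<comment> \<open>The maximum secures \<open>1 \<le> M\<close>, which later yields
    \<open>s \<le> M * s\<close>.\<close>
  proof (rule that[of "max 1 B"])
    fix z assume "A *v z = 0"
    then have eq: "p (g (p z)) = p z" using g(3) by blast
    have "g (p z) $ j = z $ j" if "j \<in> J" for j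
      using arg_cong[OF eq, of "\<lambda>w. w $ j"] that by (simp add: p_def)
    moreover have "A *v g (p z) = 0" using g(1) by auto
    moreover have "norm (p z) \<le> (\<Sum>j\<in>J. \<bar>z $ j\<bar>)"
    proof -
      have "norm (p z) \<le> (\<Sum>i\<in>UNIV. \<bar>p z $ i\<bar>)" by (rule norm_le_l1_cart)
      also have "\<dots> = (\<Sum>j\<in>J. \<bar>z $ j\<bar>)"
        by (intro sum.mono_neutral_cong_right) (auto simp: p_def)
      finally show ?thesis .
    qed
    then have "norm (g (p z)) \<le> max 1 B * (\<Sum>j\<in>J. \<bar>z $ j\<bar>)"
      by (intro order_trans[OF B(2)] mult_mono) auto
    ultimately show "\<exists>z'. A *v z' = 0 \<and> (\<forall>j\<in>J. z' $ j = z $ j) \<and>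
        norm z' \<le> max 1 B * (\<Sum>j\<in>J. \<bar>z $ j\<bar>)" by blast
  qed simp
qed

text \<open>The mean value theorem gives the gradient at a point of the segment; moving it to
  \<open>x\<close> costs at most \<open>K\<close> times the distance. The gradient is wanted at
  \<open>x\<close> because the subgradient \<open>v\<close> is related to it there.\<close>

lemma gradient_descent_bound:
  fixes f :: "'a::euclidean_space \<Rightarrow> real"
  assumes g: "\<And>x. GDERIV f x :> gradf x" and U: "convex U" "K-lipschitz_on U gradf"
    and xy: "x \<in> U" "y \<in> U"
  shows "f x - f y \<le> gradf x \<bullet> (x - y) + K * (norm (x - y))\<^sup>2"
proof -
  define h where "h t = f (y + t *\<^sub>R (x - y))" for t
  have der: "(h has_real_derivative gradf (y + t *\<^sub>R (x - y)) \<bullet> (x - y)) (at t)" for t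
  proof -
    have "((\<lambda>t. y + t *\<^sub>R (x - y)) has_derivative (\<lambda>s. s *\<^sub>R (x - y))) (at t)"
      by (auto intro!: derivative_eq_intros)
    moreover have "(f has_derivative (\<lambda>h. h \<bullet> gradf (y + t *\<^sub>R (x - y)))) (at (y + t *\<^sub>R (x - y)))"
      using g unfolding gderiv_def by blast
    ultimately have "(h has_derivative (\<lambda>s. (s *\<^sub>R (x - y)) \<bullet> gradf (y + t *\<^sub>R (x - y)))) (at t)"
      unfolding h_def by (rule has_derivative_compose)
    then show ?thesis
      by (simp add: has_field_derivative_def inner_commute mult_commute_abs)
  qed
  obtain t where t: "0 < t" "t < 1" "h 1 - h 0 = gradf (y + t *\<^sub>R (x - y)) \<bullet> (x - y)"
    using MVT2[of 0 1 h "\<lambda>t. gradf (y + t *\<^sub>R (x - y)) \<bullet> (x - y)"] der by auto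
  let ?w = "y + t *\<^sub>R (x - y)"
  have "?w = (1 - t) *\<^sub>R y + t *\<^sub>R x" by (simp add: algebra_simps)
  then have w: "?w \<in> U" using convexD[OF U(1) xy(2,1), of "1 - t" t] t by simp
  have "(gradf ?w - gradf x) \<bullet> (x - y) \<le> norm (gradf ?w - gradf x) * norm (x - y)"
    by (rule norm_cauchy_schwarz)
  also have "\<dots> \<le> (K * norm (x - y)) * norm (x - y)"
  proof (rule mult_right_mono)
    have "norm (gradf ?w - gradf x) \<le> K * norm (?w - x)"
      using lipschitz_on_normD[OF U(2) w xy(1)] .
    also have "?w - x = (1 - t) *\<^sub>R (y - x)" by (simp add: algebra_simps)
    also have "norm \<dots> = (1 - t) * norm (x - y)" using t by (simp add: norm_minus_commute)
    also have "K * \<dots> \<le> K * norm (x - y)"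
      using t lipschitz_on_nonneg[OF U(2)] by (intro mult_left_mono mult_left_le_one_le) auto
    finally show "norm (gradf ?w - gradf x) \<le> K * norm (x - y)" .
  qed simp
  finally show ?thesis
    using t(3) by (simp add: h_def inner_diff_left power2_eq_square mult.assoc)
qed

lemma positive_lower_bound:
  fixes g :: "'a \<Rightarrow> real"
  assumes "finite I" "\<And>i. i \<in> I \<Longrightarrow> 0 < g i"
  obtains e where "0 < e" "\<And>i. i \<in> I \<Longrightarrow> e \<le> g i"
  \<comment> \<open>The inserted 1 covers empty \<open>I\<close>.\<close>
  using that[of "Min (insert 1 (g ` I))"] assms by simp

lemma inner_split_coords:
  fixes v w :: "real^'n"
  shows "v \<bullet> w = (\<chi> i. if i \<in> J then 0 else v $ i) \<bullet> w + (\<Sum>j\<in>J. v $ j * w $ j)"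
proof -
  have "(\<Sum>j\<in>J. v $ j * w $ j) = (\<Sum>i\<in>UNIV. if i \<in> J then v $ i * w $ i else 0)"
    by (simp add: sum.If_cases)
  then show ?thesis
    by (simp add: inner_vec_def flip: sum.distrib) (rule sum.cong, auto)
qed

text \<open>Combining the two bounds on \<open>P\<close> cancels one factor \<open>P\<close> and
  gives \<open>P \<le> 2 / l * W\<close>; the first one then bounds \<open>S\<close> by a multiple
  of \<open>W\<close>. The remaining terms are multiples of \<open>S\<close> (as
  \<open>S \<le> 1\<close>) or of the square of \<open>a\<close>, which is at most
  \<open>W / d\<close>.\<close>

lemma weighted_residual_bound:
  fixes l d M K c S P Q W a D :: real
  assumes pos: "0 < l" "0 < d" "0 \<le> K" "0 \<le> c" "0 \<le> S" "S \<le> 1" "0 \<le> a" "0 \<le> Q"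
    and W: "d * a\<^sup>2 + Q \<le> W"
    and small: "a * M \<le> l / 4"
    and P: "l / 2 * S \<le> P" "P\<^sup>2 \<le> S * Q"
    and D: "D \<le> P + a * (M * S) + K * (M * S)\<^sup>2 + c * (K * (M * S) + a)\<^sup>2"
  shows "D \<le> (2 / l + (l / 4 + K * M\<^sup>2 + 2 * c * (K * M)\<^sup>2) * (4 / l\<^sup>2) + 2 * c / d) * W"
proof -
  have a2: "a\<^sup>2 \<le> W / d" and QW: "Q \<le> W"
    using W pos by (simp_all add: field_simps) (smt (verit) mult_nonneg_nonneg zero_le_power2)+
  have P0: "0 \<le> P" using P(1) pos by (smt (verit) divide_nonneg_nonneg mult_nonneg_nonneg)
  have PW: "P \<le> 2 / l * W"
  proof (cases "P = 0")
    case False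
    have "l / 2 * P * P \<le> l / 2 * S * Q"
      using P(2) pos(1) by (simp add: power2_eq_square mult.assoc)
    also have "\<dots> \<le> P * W"
      using P(1) QW P0 pos(8) by (intro mult_mono) auto
    finally have "l / 2 * P \<le> W" using False P0 by simp
    then show ?thesis using pos(1) by (simp add: field_simps)
  qed (use QW pos in simp)
  have "S \<le> 2 / l * P" using P(1) pos(1) by (simp add: field_simps)
  also have "\<dots> \<le> 2 / l * (2 / l * W)" using PW pos(1) by (intro mult_left_mono) auto
  finally have SW: "S \<le> 4 / l\<^sup>2 * W" by (simp add: power2_eq_square)
  have S2: "S\<^sup>2 \<le> S" using pos(5,6) by (simp add: power2_eq_square mult_left_le)
  have "a * (M * S) \<le> l / 4 * S"
    using mult_right_mono[OF small pos(5)] by (simp add: mult.assoc)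
  moreover have "K * (M * S)\<^sup>2 \<le> K * M\<^sup>2 * S"
    using S2 pos(3) by (simp add: power_mult_distrib mult.assoc mult_left_mono)
  moreover have "c * (K * (M * S) + a)\<^sup>2 \<le> c * (2 * (K * M)\<^sup>2 * S + 2 * (W / d))"
  proof (rule mult_left_mono)
    have "(K * (M * S) + a)\<^sup>2 \<le> 2 * (K * (M * S))\<^sup>2 + 2 * a\<^sup>2"
      using sum_squares_bound[of "K * (M * S)" a] by (simp add: power2_sum)
    moreover have "(K * (M * S))\<^sup>2 \<le> (K * M)\<^sup>2 * S"
      using mult_left_mono[OF S2, of "(K * M)\<^sup>2"] by (simp add: power_mult_distrib mult.assoc)
    ultimately show "(K * (M * S) + a)\<^sup>2 \<le> 2 * (K * M)\<^sup>2 * S + 2 * (W / d)"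
      using a2 by linarith
  qed (rule pos(4))
  ultimately have "D \<le> P + (l / 4 + K * M\<^sup>2 + 2 * c * (K * M)\<^sup>2) * S + 2 * c / d * W"
    using D by (simp add: algebra_simps)
  moreover have "(l / 4 + K * M\<^sup>2 + 2 * c * (K * M)\<^sup>2) * S
      \<le> (l / 4 + K * M\<^sup>2 + 2 * c * (K * M)\<^sup>2) * (4 / l\<^sup>2 * W)"
    using SW pos by (intro mult_left_mono) auto
  ultimately show ?thesis using PW by (simp add: algebra_simps)
qed

section \<open>Reduction of the SKL inequality to a weighted sum\<close>

text \<open>The weighted sum is the squared norm of \<open>diag_sqrt x v\<close>, so
  \<open>bound\<close> says that this norm is at least \<open>sqrt (s / C)\<close>. The constant
  \<open>2 * sqrt C\<close> is chosen to make the derivative exactly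
  \<open>sqrt (C / s)\<close>.\<close>

lemma SKL_exponent_halfI:
  assumes C: "0 < C" and U: "open U" "xs \<in> U"
    and fin: "\<bar>F xs\<bar> \<noteq> \<infinity>"
    and bound: "\<And>x s v. x \<in> U \<Longrightarrow> F x - F xs = ereal s \<Longrightarrow> 0 < s \<Longrightarrow> v \<in> limiting_subdiff F x \<Longrightarrow>
      s \<le> C * (\<Sum>i\<in>UNIV. x $ i * (v $ i)\<^sup>2)"
    and nonneg: "\<And>x i. \<bar>F x\<bar> \<noteq> \<infinity> \<Longrightarrow> 0 \<le> x $ i"
  shows "SKL_exponent_half F xs"
proof -
  have "1 \<le> ereal (deriv (\<lambda>s. (2 * sqrt C) * s powr (1/2)) (real_of_ereal (F x - F xs)))
                 * dist0 (diag_sqrt x ` limiting_subdiff F x)"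
    if x: "x \<in> U" "F xs < F x" "F x < F xs + \<infinity>" for x
  proof -
    obtain s where s: "F x - F xs = ereal s" and Fx: "\<bar>F x\<bar> \<noteq> \<infinity>"
      using x fin by (cases "F x"; cases "F xs") auto
    have s0: "0 < s" using s x(2) fin by (cases "F x"; cases "F xs") auto
    have "((\<lambda>s. (2 * sqrt C) * s powr (1/2)) has_real_derivative
        (2 * sqrt C) * (1/2 * s powr (1/2 - 1))) (at s)"
      using s0 by (auto intro!: derivative_eq_intros)
    then have "deriv (\<lambda>s. (2 * sqrt C) * s powr (1/2)) s = sqrt C * s powr (- (1/2))"
      by (simp add: DERIV_imp_deriv)
    also have "\<dots> = sqrt (C / s)"
      using s0 by (simp add: powr_minus powr_half_sqrt real_sqrt_divide field_simps)
    finally have d: "deriv (\<lambda>s. (2 * sqrt C) * s powr (1/2)) s = sqrt (C / s)" .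
    have "ereal (sqrt (s / C)) \<le> dist0 (diag_sqrt x ` limiting_subdiff F x)"
      unfolding dist0_def
    proof (rule INF_greatest, safe)
      fix v assume v: "v \<in> limiting_subdiff F x"
      have "s / C \<le> (\<Sum>i\<in>UNIV. x $ i * (v $ i)\<^sup>2)"
        using bound[OF x(1) s s0 v] C by (simp add: field_simps)
      also have "\<dots> = (\<Sum>i\<in>UNIV. (diag_sqrt x v $ i)\<^sup>2)"
        using nonneg[OF Fx] by (simp add: diag_sqrt_def power_mult_distrib)
      finally have "sqrt (s / C) \<le> sqrt (\<Sum>i\<in>UNIV. (diag_sqrt x v $ i)\<^sup>2)" by simp
      then show "ereal (sqrt (s / C)) \<le> ereal (dist 0 (diag_sqrt x v))"
        by (simp add: norm_vec_def L2_set_def)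
    qed
    then have "ereal (sqrt (C / s)) * ereal (sqrt (s / C))
        \<le> ereal (sqrt (C / s)) * dist0 (diag_sqrt x ` limiting_subdiff F x)"
      using C s0 by (intro ereal_mult_left_mono) auto
    moreover have "sqrt (C / s) * sqrt (s / C) = 1"
      using C s0 by (simp flip: real_sqrt_mult)
    ultimately show ?thesis using s d by (simp add: one_ereal_def)
  qed
  then show ?thesis
    unfolding SKL_exponent_half_def using C U
    by (intro exI[of _ "2 * sqrt C"] exI[of _ \<infinity>] exI[of _ U]) auto
qed

section \<open>The SKL exponent under strict complementarity\<close>

theorem theorem3:
  fixes A :: "real^'n^'m" and b :: "real^'m"
    and f :: "real^'n \<Rightarrow> real" and gradf :: "real^'n \<Rightarrow> real^'n"
    and L :: real and xs :: "real^'n" and F :: "real^'n \<Rightarrow> ereal"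
  assumes full_row_rank: "rank A = CARD('m)"
    and strictly_feasible: "\<exists>x\<in>feasible A b. \<forall>i. 0 < x $ i"
    and gradient: "\<And>x. GDERIV f x :> gradf x"
    and gradient_continuous: "continuous_on UNIV gradf"
    and L_pos: "0 < L"
    and relatively_smooth: "rel_smooth_on (feasible A b) L h_S f"
    and optimal_exists: "\<exists>x\<in>feasible A b. \<forall>y\<in>feasible A b. f x \<le> f y"
    and F_eq: "F = (\<lambda>x. ereal (f x) + set_delta (feasible A b) x)"
    and xs_feasible: "xs \<in> feasible A b"
    and xs_critical: "critical_point F xs"
    and KL: "KL_exponent_half F xs"
    and gradient_locally_lipschitz: "\<exists>U K. open U \<and> xs \<in> U \<and> K-lipschitz_on U gradf"
    and strict_complementarity:
      "\<exists>(mu::real^'m) (lam::real^'n).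
         gradf xs + transpose A *v mu - lam = 0 \<and> (\<forall>i. 0 \<le> lam $ i) \<and>
         lam \<bullet> xs = 0 \<and> (\<forall>i. 0 < (xs + lam) $ i)"
  shows "SKL_exponent_half F xs"
proof -
  define S where "S = feasible A b"
  have FS: "F = (\<lambda>x. ereal (f x) + set_delta S x)" by (simp add: F_eq S_def)
  have F_in: "F x = ereal (f x)" if "x \<in> S" for x
    using that by (simp add: FS set_delta_def)
  have F_fin: "x \<in> S" if "\<bar>F x\<bar> \<noteq> \<infinity>" for x
    using that by (auto simp: FS set_delta_def split: if_splits)
  have xsS: "xs \<in> S" using xs_feasible by (simp add: S_def)
  then have Axs: "A *v xs = b" and xs0: "0 \<le> xs $ i" for i by (simp_all add: S_def feasible_def)
  define J where "J = {j. xs $ j = 0}"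

  \<comment> \<open>Multipliers and linear growth at \<open>xs\<close>\<close>
  obtain mu :: "real^'m" and lam :: "real^'n" where
    stat: "gradf xs + transpose A *v mu - lam = 0" and lam0: "\<And>i. 0 \<le> lam $ i"
    and compl: "lam \<bullet> xs = 0" and strict: "\<And>i. 0 < (xs + lam) $ i"
    using strict_complementarity by blast
  have "lam $ i * xs $ i = 0" for i
    using compl lam0 xs0 by (simp add: inner_vec_def sum_nonneg_eq_0_iff)
  then have lamI: "lam $ i = 0" if "i \<notin> J" for i using that by (auto simp: J_def)
  have lamJ: "0 < lam $ j" if "j \<in> J" for j using strict[of j] that by (simp add: J_def)
  obtain l where l: "0 < l" "\<And>j. j \<in> J \<Longrightarrow> l \<le> lam $ j"
    using positive_lower_bound[of J "\<lambda>j. lam $ j"] lamJ by auto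
  \<comment> \<open>On the kernel of \<open>A\<close> the \<open>mu\<close> term vanishes, and
    complementarity leaves only the coordinates of \<open>lam\<close> in \<open>J\<close>, each at
    least \<open>l\<close>.\<close>
  have grad_xs: "l * (\<Sum>j\<in>J. z $ j) \<le> gradf xs \<bullet> z"
    if "A *v z = 0" "\<And>j. j \<in> J \<Longrightarrow> 0 \<le> z $ j" for z
  proof -
    have "gradf xs = lam - mu v* A" using stat by (simp add: algebra_simps)
    then have "gradf xs \<bullet> z = lam \<bullet> z"
      using that(1) by (simp add: inner_diff_left dot_lmul_matrix)
    also have "\<dots> = (\<Sum>j\<in>J. lam $ j * z $ j)"
      unfolding inner_vec_def using lamI by (intro sum.mono_neutral_cong_right) auto
    finally show ?thesis
      using l(2) that(2) by (auto simp: sum_distrib_left intro!: sum_mono mult_right_mono)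
  qed

  \<comment> \<open>Constants and neighbourhoods\<close>
  obtain d0 where d0: "0 < d0" "\<And>i. i \<in> - J \<Longrightarrow> d0 \<le> xs $ i"
    using positive_lower_bound[of "- J" "\<lambda>i. xs $ i"] xs0 by (auto simp: J_def less_le)
  \<comment> \<open>Half of the gap: moving by less than \<open>d\<close> keeps every inactive
    coordinate at least \<open>d\<close>.\<close>
  define d where "d = d0 / 2"
  have d: "0 < d" "\<And>i. i \<notin> J \<Longrightarrow> 2 * d \<le> xs $ i" using d0 by (auto simp: d_def)

  obtain M where M: "1 \<le> M" and lift: "\<And>z. A *v z = 0 \<Longrightarrow>
      \<exists>z'. A *v z' = 0 \<and> (\<forall>j\<in>J. z' $ j = z $ j) \<and> norm z' \<le> M * (\<Sum>j\<in>J. \<bar>z $ j\<bar>)"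
    using kernel_lift_bound[of A J] by metis

  obtain c e0 \<eta> where KLc: "0 < c" "0 < e0" "0 < \<eta>"
    and KLb: "\<And>x. norm (x - xs) \<le> e0 \<Longrightarrow> F xs < F x \<Longrightarrow> F x < F xs + ereal \<eta> \<Longrightarrow>
           F x - F xs \<le> ereal c * (dist0 (limiting_subdiff F x))\<^sup>2"
    using KL unfolding KL_exponent_half_def by blast

  obtain U K where U: "open U" "xs \<in> U" and lip: "K-lipschitz_on U gradf"
    using gradient_locally_lipschitz by blast
  have K: "0 \<le> K" using lip by (rule lipschitz_on_nonneg)
  obtain r1 where r1: "0 < r1" "ball xs r1 \<subseteq> U" using U open_contains_ball by blast
  have "isCont f xs" using gradient[of xs] unfolding gderiv_def by (rule has_derivative_continuous)
  \<comment> \<open>The bound 1 serves the case of large \<open>a\<close>; the bound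
    \<open>\<eta>\<close> places the face point \<open>y\<close> in the KL range.\<close>
  then obtain r2 where r2: "0 < r2" "\<And>y. dist y xs < r2 \<Longrightarrow> \<bar>f y - f xs\<bar> < min 1 \<eta>"
    using KLc(3) unfolding continuous_at_eps_delta
    by (metis dist_real_def min_less_iff_conj zero_less_one)

  \<comment> \<open>In order: Lipschitz ball, control of values, KL radius, positivity off
    \<open>J\<close>, \<open>s \<le> 1\<close>, and \<open>K * \<rho> * M \<le> l / 4\<close>. Using
    \<open>K + 1\<close> avoids a zero denominator.\<close>
  define \<rho> where "\<rho> = Min {r1, r2, e0, d, 1, l / (4 * (K + 1) * M)}"
  have "0 < l / (4 * (K + 1) * M)" using l K M by auto
  then have \<rho>: "0 < \<rho>" "\<rho> \<le> r1" "\<rho> \<le> r2" "\<rho> \<le> e0" "\<rho> \<le> d" "\<rho> \<le> 1" "\<rho> \<le> l / (4 * (K + 1) * M)"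
    unfolding \<rho>_def using r1 r2 KLc d by auto
  have "\<rho> * (4 * (K + 1) * M) \<le> l"
    using \<rho>(7) K M by (simp add: pos_le_divide_eq)
  moreover have "0 \<le> \<rho> * M" using \<rho>(1) M by simp
  ultimately have K\<rho>: "K * \<rho> * M \<le> l / 4" by (simp add: algebra_simps)
  have lip\<rho>: "K-lipschitz_on (ball xs \<rho>) gradf"
    using lip r1 \<rho>(2) by (meson lipschitz_on_subset order_trans subset_ball)
  have xs\<rho>: "xs \<in> ball xs \<rho>" using \<rho> by simp

  define n where "n = real CARD('n)"
  \<comment> \<open>If \<open>x\<close> is within \<open>r\<close>, then
    \<open>s \<le> n * r\<close> and the lift has norm at most \<open>M * (n * r)\<close>, so
    \<open>x - z\<close> stays within \<open>r + M * (n * r) = \<rho>\<close>.\<close>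
  define r where "r = \<rho> / (1 + M * n)"
  have n: "0 \<le> n" by (simp add: n_def)
  have Mn: "0 \<le> M * n" using M n by simp
  have r: "0 < r" using \<rho>(1) Mn by (simp add: r_def add_pos_nonneg)
  have "r * (1 + M * n) = \<rho>" using Mn by (simp add: r_def)
  then have "r + M * (n * r) = \<rho>" by (simp add: algebra_simps)
  have "0 \<le> M * (n * r)" using M n r by simp
  then have r\<rho>: "r \<le> \<rho>" "M * (n * r) \<le> \<rho>" "r + M * (n * r) = \<rho>"
    using r \<open>r + M * (n * r) = \<rho>\<close> by linarith+

  define C0 where "C0 = 2 / l + (l / 4 + K * M\<^sup>2 + 2 * c * (K * M)\<^sup>2) * (4 / l\<^sup>2) + 2 * c / d"
  \<comment> \<open>The reciprocal of the lower bound that \<open>d * a\<^sup>2 \<le> W\<close>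
    provides when \<open>a * M\<close> exceeds \<open>l / 4\<close>.\<close>
  define C1 where "C1 = 16 * M\<^sup>2 / (d * l\<^sup>2)"
  have C0: "0 < C0" unfolding C0_def using l K M KLc d by (intro add_pos_nonneg) auto
  have C1: "0 < C1" unfolding C1_def using l M d by auto

  \<comment> \<open>The residual bound at a feasible point near \<open>xs\<close>\<close>
  have main: "f x - f xs \<le> (C0 + C1) * (\<Sum>i\<in>UNIV. x $ i * (v $ i)\<^sup>2)"
    if x: "x \<in> ball xs r" "x \<in> S" and v: "v \<in> limiting_subdiff F x" for x v
  proof -
    define W where "W = (\<Sum>i\<in>UNIV. x $ i * (v $ i)\<^sup>2)"
    define Q where "Q = (\<Sum>j\<in>J. x $ j * (v $ j)\<^sup>2)"
    define s where "s = (\<Sum>j\<in>J. x $ j)"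
    define vI :: "real^'n" where "vI = (\<chi> i. if i \<in> J then 0 else v $ i)"
    define a where "a = norm vI"
    have split: "v \<bullet> w = vI \<bullet> w + (\<Sum>j\<in>J. v $ j * w $ j)" for w
      unfolding vI_def by (rule inner_split_coords)
    have Ax: "A *v x = b" and x0: "0 \<le> x $ i" for i using x by (simp_all add: S_def feasible_def)
    have xr: "norm (x - xs) < r" using x by (simp add: dist_norm norm_minus_commute)
    have x\<rho>: "x \<in> ball xs \<rho>" using x r\<rho>(1) by auto
    have xI: "d \<le> x $ i" if "i \<notin> J" for i
      using component_le_norm_cart[of "x - xs" i] xr r\<rho> \<rho>(5) d(2)[OF that] by auto
    have a0: "0 \<le> a" by (simp add: a_def)
    have Q0: "0 \<le> Q" unfolding Q_def using x0 by (intro sum_nonneg) auto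
    have s0: "0 \<le> s" unfolding s_def using x0 by (intro sum_nonneg) auto
    have "a\<^sup>2 = (\<Sum>i\<in>-J. (v $ i)\<^sup>2)"
      unfolding a_def vI_def power2_norm_eq_inner inner_vec_def
      by (intro sum.mono_neutral_cong_right) (auto simp: power2_eq_square)
    moreover have "d * (\<Sum>i\<in>-J. (v $ i)\<^sup>2) \<le> (\<Sum>i\<in>-J. x $ i * (v $ i)\<^sup>2)"
      unfolding sum_distrib_left using xI by (intro sum_mono mult_right_mono) auto
    moreover have "W = (\<Sum>i\<in>-J. x $ i * (v $ i)\<^sup>2) + Q"
      unfolding W_def Q_def
      using sum.union_disjoint[of "- J" J "\<lambda>i. x $ i * (v $ i)\<^sup>2"] by (simp add: Un_commute)
    ultimately have W: "d * a\<^sup>2 + Q \<le> W" by simp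
    have W0: "0 \<le> W" unfolding W_def using x0 by (intro sum_nonneg) auto
    have "f x - f xs \<le> C1 * W \<or> f x - f xs \<le> C0 * W"
    proof (cases "a * M \<le> l / 4")
      case False
      then have "(l / 4)\<^sup>2 \<le> (a * M)\<^sup>2" using l by (intro power_mono) auto
      then have "d * (l\<^sup>2 / 16) \<le> d * (a\<^sup>2 * M\<^sup>2)"
        using d by (simp add: power_divide power_mult_distrib)
      also have "\<dots> \<le> W * M\<^sup>2"
        using W Q0 mult_right_mono[of "d * a\<^sup>2" W "M\<^sup>2"] by simp
      finally have "1 \<le> C1 * W" using l d by (simp add: C1_def field_simps)
      moreover have "f x - f xs < 1"
        using r2(2)[of x] x\<rho> \<rho>(3) by (auto simp: dist_commute)
      ultimately show ?thesis by simp
    next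
      case True
      \<comment> \<open>The vector to lift is \<open>x - xs\<close>: it lies in the kernel and
        agrees with \<open>x\<close> on \<open>J\<close>, where \<open>xs\<close> vanishes.\<close>
      have "A *v (x - xs) = 0" using Ax Axs by (simp add: matrix_vector_mult_diff_distrib)
      from lift[OF this] obtain z where Az: "A *v z = 0"
        and zJ0: "\<forall>j\<in>J. z $ j = (x - xs) $ j"
        and nz0: "norm z \<le> M * (\<Sum>j\<in>J. \<bar>(x - xs) $ j\<bar>)" by blast
      have zJ: "z $ j = x $ j" if "j \<in> J" for j using zJ0 that by (simp add: J_def)
      have s_eq: "(\<Sum>j\<in>J. \<bar>(x - xs) $ j\<bar>) = s"
        unfolding s_def using x0 by (intro sum.cong) (auto simp: J_def)
      have nz: "norm z \<le> M * s" using nz0 s_eq by simp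
      have "s \<le> (\<Sum>j\<in>J. r)"
        unfolding s_eq[symmetric] using component_le_norm_cart[of "x - xs"] xr
        by (intro sum_mono) (meson less_imp_le order_trans)
      also have "\<dots> \<le> n * r" using r by (simp add: n_def card_mono)
      finally have snr: "s \<le> n * r" .
      then have "M * s \<le> M * (n * r)" using M by (intro mult_left_mono) auto
      then have Ms: "M * s \<le> \<rho>" and Msr: "r + M * s \<le> \<rho>" using r r\<rho> by linarith+
      have "s \<le> M * s" using M s0 mult_right_mono[of 1 M s] by simp
      then have s1: "s \<le> 1" using Ms \<rho>(6) by linarith

      define y where "y = x - z"
      have "norm (y - xs) \<le> norm (x - xs) + norm z"
        unfolding y_def using norm_triangle_ineq4[of "x - xs" z] by (simp add: algebra_simps)
      then have y_near: "norm (y - xs) < \<rho>" using xr nz Msr by linarith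
      then have y\<rho>: "y \<in> ball xs \<rho>" by (simp add: dist_norm norm_minus_commute)
      have yJ: "y $ j = 0" if "j \<in> J" for j using zJ[OF that] by (simp add: y_def)
      have yI: "0 < y $ i" if "i \<notin> J" for i
        using component_le_norm_cart[of "y - xs" i] y_near \<rho>(5) d(1) d(2)[OF that] by auto
      have Ay: "A *v y = b" using Ax Az by (simp add: y_def matrix_vector_mult_diff_distrib)
      have yS: "y \<in> S"
        using Ay yJ yI by (auto simp: S_def feasible_def) (metis less_eq_real_def)

      have tangent: "v \<bullet> w = gradf x \<bullet> w" if "A *v w = 0" "\<And>i. x $ i = 0 \<Longrightarrow> w $ i = 0" for w
        by (rule limiting_subdiff_feasible_direction[OF gradient gradient_continuous
              v[unfolded F_eq] that])
      have suppJ: "i \<in> J" if "x $ i = 0" for i using xI[of i] d(1) that by force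
      define P where "P = (\<Sum>j\<in>J. v $ j * x $ j)"
      \<comment> \<open>Zero coordinates of \<open>x\<close> lie in \<open>J\<close>, where
        \<open>z\<close> equals \<open>x\<close>, so \<open>z\<close> is an admissible direction.
        The uncontrolled part of \<open>v\<close> enters only through \<open>P\<close>.\<close>
      have vz: "gradf x \<bullet> z = vI \<bullet> z + P"
        using tangent[OF Az] suppJ zJ split[of z] by (simp add: P_def)
      have vIz: "\<bar>vI \<bullet> z\<bar> \<le> a * (M * s)"
        using Cauchy_Schwarz_ineq2[of vI z] mult_left_mono[OF nz a0] by (simp add: a_def)
      \<comment> \<open>Of the growth \<open>l * s\<close>, replacing \<open>gradf xs\<close> by
        \<open>gradf x\<close> loses a quarter and the \<open>vI\<close> term another; half is left
        for \<open>P\<close>.\<close>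
      have "l * s \<le> gradf xs \<bullet> z"
        using grad_xs[OF Az] zJ x0 by (simp add: s_def)
      moreover have "\<bar>(gradf x - gradf xs) \<bullet> z\<bar> \<le> l / 4 * s"
      proof -
        have "norm (gradf x - gradf xs) \<le> K * norm (x - xs)"
          using lipschitz_on_normD[OF lip\<rho> x\<rho> xs\<rho>] .
        also have "\<dots> \<le> K * \<rho>" using xr r\<rho> K by (intro mult_left_mono) auto
        finally have "norm (gradf x - gradf xs) * norm z \<le> K * \<rho> * (M * s)"
          using nz by (intro mult_mono) (auto intro: order_trans[OF norm_ge_zero])
        also have "\<dots> \<le> l / 4 * s" using mult_right_mono[OF K\<rho> s0] by (simp add: mult.assoc)
        finally show ?thesis using Cauchy_Schwarz_ineq2 order_trans by blast
      qed
      moreover have "a * (M * s) \<le> l / 4 * s"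
        using mult_right_mono[OF True s0] by (simp add: mult.assoc)
      ultimately have P1: "l / 2 * s \<le> P" using vz vIz unfolding inner_diff_left by linarith
      have P2: "P\<^sup>2 \<le> s * Q"
      proof -
        \<comment> \<open>Splitting the weight evenly makes Cauchy-Schwarz produce \<open>s\<close>
          and \<open>Q\<close>.\<close>
        have "P = (\<Sum>j\<in>J. sqrt (x $ j) * (sqrt (x $ j) * v $ j))"
          unfolding P_def using x0 by (simp flip: mult.assoc) (simp add: mult.commute)
        then have "P\<^sup>2 \<le> (\<Sum>j\<in>J. (sqrt (x $ j))\<^sup>2) * (\<Sum>j\<in>J. (sqrt (x $ j) * v $ j)\<^sup>2)"
          using Cauchy_Schwarz_ineq_sum by simp
        then show ?thesis using x0 by (simp add: s_def Q_def power_mult_distrib)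
      qed

      have "f x - f y \<le> gradf x \<bullet> (x - y) + K * (norm (x - y))\<^sup>2"
        by (rule gradient_descent_bound[OF gradient convex_ball lip\<rho> x\<rho> y\<rho>])
      also have "x - y = z" by (simp add: y_def)
      also have "gradf x \<bullet> z + K * (norm z)\<^sup>2 \<le> P + a * (M * s) + K * (M * s)\<^sup>2"
        using vz vIz nz K by (intro add_mono mult_left_mono power_mono) auto
      finally have fxy: "f x - f y \<le> P + a * (M * s) + K * (M * s)\<^sup>2" .

      \<comment> \<open>The KL inequality on the face\<close>
      have fyxs: "f y - f xs \<le> c * (K * (M * s) + a)\<^sup>2"
      proof (cases "f y \<le> f xs")
        case True
        then show ?thesis using KLc(1) by (smt (verit) mult_nonneg_nonneg zero_le_power2)
      next
        case False
        \<comment> \<open>The direction space of the face. Since \<open>q\<close> is orthogonal to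
          it, \<open>q \<bullet> (p - y)\<close> depends only on the \<open>J\<close>-coordinates of
          a feasible \<open>p\<close>.\<close>
        define N where "N = {w. A *v w = 0 \<and> (\<forall>j\<in>J. w $ j = 0)}"
        have "subspace N"
          by (auto simp: N_def subspace_def matrix_vector_right_distrib matrix_vector_mult_scaleR)
        then have spanN: "span N = N" by (simp add: span_eq_iff)
        obtain u q where u: "u \<in> N" and q: "\<And>w. w \<in> N \<Longrightarrow> orthogonal q w"
          and uq: "gradf y = u + q"
          using orthogonal_subspace_decomp_exists[of N "gradf y"] spanN by metis
        have qw: "q \<bullet> w = 0" if "w \<in> N" for w using q[OF that] by (simp add: orthogonal_def)
        have nxy: "norm (gradf y - gradf x) \<le> K * (M * s)"
        proof -
          have "norm (gradf y - gradf x) \<le> K * norm (y - x)"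
            using lipschitz_on_normD[OF lip\<rho> y\<rho> x\<rho>] .
          also have "\<dots> \<le> K * (M * s)" using nz K by (simp add: y_def mult_left_mono)
          finally show ?thesis .
        qed
        have nu: "norm u \<le> K * (M * s) + a"
        proof -
          \<comment> \<open>As \<open>u\<close> vanishes on \<open>J\<close>, it is admissible for
            \<open>tangent\<close> and sees only \<open>vI\<close>. Hence the squared norm of
            \<open>u\<close> involves just the gradient change and \<open>vI\<close>.\<close>
          have "v \<bullet> u = gradf x \<bullet> u" using tangent u suppJ by (auto simp: N_def)
          moreover have "v \<bullet> u = vI \<bullet> u" using split[of u] u by (simp add: N_def)
          moreover have "u \<bullet> u = gradf y \<bullet> u" using qw[OF u] by (simp add: uq inner_add_left)
          ultimately have "u \<bullet> u = (gradf y - gradf x + vI) \<bullet> u"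
            by (simp add: inner_diff_left inner_add_left)
          also have "\<dots> \<le> norm (gradf y - gradf x + vI) * norm u" by (rule norm_cauchy_schwarz)
          also have "\<dots> \<le> (K * (M * s) + a) * norm u"
            using norm_triangle_ineq[of "gradf y - gradf x" vI] nxy
            by (intro mult_right_mono) (auto simp: a_def)
          finally have "norm u * norm u \<le> (K * (M * s) + a) * norm u"
            by (simp add: power2_norm_eq_inner flip: power2_eq_square)
          moreover have "0 \<le> K * (M * s) + a" using K M s0 a0 by auto
          ultimately show ?thesis by (cases "u = 0") auto
        qed
        \<comment> \<open>The normal part \<open>q = gradf y - u\<close> has positive multipliers on \<open>J\<close>, being close to those of \<open>xs\<close>.\<close>
        have "u \<in> regular_subdiff F y"
          unfolding FS
        proof (rule regular_subdiff_constrainedI[OF gradient yS])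
          fix p assume "p \<in> S"
          then have Ap: "A *v p = b" and p0: "0 \<le> p $ i" for i by (simp_all add: S_def feasible_def)
          have Apy: "A *v (p - y) = 0" using Ap Ay by (simp add: matrix_vector_mult_diff_distrib)
          \<comment> \<open>Modulo \<open>N\<close> the step \<open>p - y\<close> may be replaced by
            a lift of norm at most \<open>M * t\<close>. Error and growth are then both linear in
            \<open>t\<close>, so the inequality holds for every feasible \<open>p\<close>, however
            far away.\<close>
          from lift[OF Apy] obtain w where Aw: "A *v w = 0"
            and wJ0: "\<forall>j\<in>J. w $ j = (p - y) $ j"
            and nw0: "norm w \<le> M * (\<Sum>j\<in>J. \<bar>(p - y) $ j\<bar>)" by blast
          define t where "t = (\<Sum>j\<in>J. p $ j)"
          have t0: "0 \<le> t" unfolding t_def using p0 by (intro sum_nonneg) auto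
          have wJ: "w $ j = p $ j" if "j \<in> J" for j using wJ0 that yJ by simp
          have "(\<Sum>j\<in>J. \<bar>(p - y) $ j\<bar>) = t"
            unfolding t_def using p0 yJ by (intro sum.cong) auto
          then have nw: "norm w \<le> M * t" using nw0 by simp
          have "p - y - w \<in> N"
            using Apy Aw wJ yJ by (simp add: N_def matrix_vector_mult_diff_distrib)
          then have "q \<bullet> (p - y) = q \<bullet> w" using qw by (fastforce simp: inner_diff_right)
          also have "\<dots> = gradf xs \<bullet> w + (gradf y - gradf xs - u) \<bullet> w"
            by (simp add: uq algebra_simps)
          finally have eq: "q \<bullet> (p - y) = gradf xs \<bullet> w + (gradf y - gradf xs - u) \<bullet> w" .
          have "norm (gradf y - gradf xs) \<le> K * norm (y - xs)"
            using lipschitz_on_normD[OF lip\<rho> y\<rho> xs\<rho>] .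
          also have "\<dots> \<le> K * \<rho>" using y_near K by (intro mult_left_mono) auto
          finally have "norm (gradf y - gradf xs - u) \<le> K * \<rho> + (K * \<rho> + a)"
            using norm_triangle_ineq4[of "gradf y - gradf xs" u] nu mult_left_mono[OF Ms K] by linarith
          then have "norm (gradf y - gradf xs - u) * norm w \<le> (K * \<rho> + (K * \<rho> + a)) * (M * t)"
            using nw by (intro mult_mono) (auto intro: order_trans[OF norm_ge_zero])
          also have "\<dots> = (K * \<rho> * M + K * \<rho> * M + a * M) * t" by (simp add: algebra_simps)
          \<comment> \<open>Each of the three summands is at most \<open>l / 4\<close>.\<close>
          also have "\<dots> \<le> l * t"
            using K\<rho> l(1) t0 \<open>a * M \<le> l / 4\<close> by (intro mult_right_mono) linarith+
          finally have "\<bar>(gradf y - gradf xs - u) \<bullet> w\<bar> \<le> l * t"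
            using Cauchy_Schwarz_ineq2 order_trans by blast
          moreover have "l * t \<le> gradf xs \<bullet> w"
            using grad_xs[OF Aw] wJ p0 by (simp add: t_def)
          ultimately have "0 \<le> q \<bullet> (p - y)" using eq by linarith
          then show "u \<bullet> (p - y) \<le> gradf y \<bullet> (p - y)" by (simp add: uq inner_add_left)
        qed
        then have "u \<in> limiting_subdiff F y" using regular_subdiff_subset_limiting by blast
        then have "dist0 (limiting_subdiff F y) \<le> ereal (norm u)"
          unfolding dist0_def by (intro INF_lower2[of u]) auto
        also have "\<dots> \<le> ereal (K * (M * s) + a)" using nu by simp
        finally have dle: "dist0 (limiting_subdiff F y) \<le> ereal (K * (M * s) + a)" .
        have d0: "0 \<le> dist0 (limiting_subdiff F y)" unfolding dist0_def by (intro INF_greatest) auto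
        have "f y < f xs + \<eta>"
          using r2(2)[of y] y_near \<rho>(3) by (auto simp: dist_norm)
        then have "F y - F xs \<le> ereal c * (dist0 (limiting_subdiff F y))\<^sup>2"
          using False y_near \<rho>(4) by (intro KLb) (auto simp: F_in[OF yS] F_in[OF xsS])
        also have "\<dots> \<le> ereal c * (ereal (K * (M * s) + a))\<^sup>2"
        proof (rule ereal_mult_left_mono)
          show "(dist0 (limiting_subdiff F y))\<^sup>2 \<le> (ereal (K * (M * s) + a))\<^sup>2"
            using dle d0 by (cases "dist0 (limiting_subdiff F y)") (auto intro: power_mono)
        qed (use KLc in simp)
        finally show ?thesis by (simp add: F_in[OF yS] F_in[OF xsS])
      qed
      have "f x - f xs \<le> C0 * W"
        unfolding C0_def
      proof (rule weighted_residual_bound[where S = s and P = P and Q = Q and a = a])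
        show "f x - f xs \<le> P + a * (M * s) + K * (M * s)\<^sup>2 + c * (K * (M * s) + a)\<^sup>2"
          using fxy fyxs by linarith
      qed (use l d K KLc s0 s1 a0 Q0 W True P1 P2 in auto)
      then show ?thesis by blast
    qed
    \<comment> \<open>Both products are nonnegative, so the sum of the constants covers either
      case.\<close>
    moreover have "0 \<le> C0 * W" "0 \<le> C1 * W" using C0 C1 W0 by auto
    ultimately show ?thesis unfolding W_def[symmetric] by (auto simp: distrib_right)
  qed

  show ?thesis
  proof (rule SKL_exponent_halfI[where C = "C0 + C1" and U = "ball xs r"])
    show "0 < C0 + C1" using C0 C1 by simp
    show "\<bar>F xs\<bar> \<noteq> \<infinity>" by (simp add: F_in[OF xsS])
    show "0 \<le> x $ i" if "\<bar>F x\<bar> \<noteq> \<infinity>" for x i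
      using F_fin[OF that] by (simp add: S_def feasible_def)
    fix x t v
    assume x: "x \<in> ball xs r" and t: "F x - F xs = ereal t" and v: "v \<in> limiting_subdiff F x"
    \<comment> \<open>Having a limiting subgradient already forces \<open>F x\<close> to be
      finite.\<close>
    have xS: "x \<in> S" using v by (intro F_fin) (simp add: limiting_subdiff_def)
    have "t = f x - f xs" using t by (simp add: F_in[OF xS] F_in[OF xsS])
    then show "t \<le> (C0 + C1) * (\<Sum>i\<in>UNIV. x $ i * (v $ i)\<^sup>2)"
      using main[OF x xS v] by simp
  qed (use r in auto)
qed

end
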